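(* Let $\eta^2=-3$ and let $L_\eta\cong\mathbb{P}^4$ be the hyperplane $u_1+\cdots+u_5=\eta a$ in $\mathbb{P}^5$ with homogeneous coordinates $a,u_1,\dots,u_5$. For $i\ne j$ in $\{1,\dots,5\}$ let $\Pi_{ij}\subset L_\eta$ be the Pascal plane $a+u_i=0,\ a-u_j=0$. Two distinct Pascal planes $\Pi_{ij}$ and $\Pi_{kl}$ meet along a line if and only if one of the following three conditions holds: $i=k$, or $j=l$, or $(i,j)=(l,k)$. In all other cases the two planes meet in a single point.
   Context: We work over $\mathbb{C}$. The twenty planes $\Pi_{ij}$, $i\neq j$, are called the Pascal planes; $\Pi_{ij}$ is identified with the directed edge $i\to j$ of the complete directed graph on the vertices $\{1,\dots,5\}$. They lie on the balanced Pascal quartic $X_\eta=\{a^4+a^2e_2(u_1,\dots,u_5)+e_4(u_1,\dots,u_5)=0\}\subset L_\eta$, where $e_r$ denotes the elementary symmetric polynomial of degree $r$. *)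

theory Defs
  imports "HOL-Analysis.Analysis"
begin

text \<open>
  A point of the complex projective space of dimension CARD('n) - 1 is a one-dimensional
  complex subspace of the coordinate space; its homogeneous coordinate vectors are the nonzero
  vectors it contains.  The prefix vec refers to linear algebra over the complex
  scalars (with respect to *s), so the dimensions below are complex dimensions.
\<close>

definition proj_space :: "(complex^'n) set set" where
  "proj_space = {P. vec.subspace P \<and> vec.dim P = 1}"

definition proj_linear :: "nat \<Rightarrow> (complex^'n) set set \<Rightarrow> bool" where
  "proj_linear d S \<longleftrightarrow>
     (\<exists>W. vec.subspace W \<and> vec.dim W = d + 1 \<and> S = {P \<in> proj_space. P \<subseteq> W})"

abbreviation proj_line :: "(complex^'n) set set \<Rightarrow> bool" where
  "proj_line \<equiv> proj_linear 1"

text \<open>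
  The type 6 has the six elements 0, ..., 5: the entry at 0 is the coordinate a, and the entry at
  i is the coordinate u_i for i in {1..5}.
\<close>

abbreviation coord_a :: "complex^6 \<Rightarrow> complex" where
  "coord_a x \<equiv> x $ 0"

abbreviation coord_u :: "complex^6 \<Rightarrow> nat \<Rightarrow> complex" where
  "coord_u x i \<equiv> x $ of_nat i"

definition L_space :: "complex \<Rightarrow> (complex^6) set set" where
  "L_space \<eta> = {P \<in> proj_space. \<forall>x\<in>P. (\<Sum>i=1..5. coord_u x i) = \<eta> * coord_a x}"

definition pascal_plane :: "complex \<Rightarrow> nat \<Rightarrow> nat \<Rightarrow> (complex^6) set set" where
  "pascal_plane \<eta> i j =
     {P \<in> L_space \<eta>. \<forall>x\<in>P. coord_a x + coord_u x i = 0 \<and> coord_a x - coord_u x j = 0}"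

end

theory Submission
  imports Defs
begin

text \<open>
  Everything is linear algebra in the affine cones over the planes. The five equations
  \<open>\<Sum>\<^sub>r u\<^sub>r = \<eta> a\<close>, \<open>u\<^sub>i = -a\<close>, \<open>u\<^sub>j = a\<close>, \<open>u\<^sub>k = -a\<close>, \<open>u\<^sub>l = a\<close> in six unknowns cut out a
  one-dimensional space exactly when they are independent. If \<open>i = k\<close> or \<open>j = l\<close>, two of
  them coincide; if \<open>(i, j) = (l, k)\<close>, they force \<open>a = u\<^sub>i = u\<^sub>j = 0\<close> and one of
  them is redundant; in these cases the solution space has dimension two. Two opposite
  equations on a single shared coordinate merely force \<open>a = 0\<close> and stay independent.
\<close>

section \<open>Linear subspaces of projective space\<close>

lemma proj_linear_subspaceI:
  "vec.subspace W \<Longrightarrow> vec.dim W = d + 1 \<Longrightarrow> proj_linear d {P \<in> proj_space. P \<subseteq> W}"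
  unfolding proj_linear_def by blast

lemma span_singleton_in_proj_space:
  fixes v :: "complex^'n"
  assumes "v \<noteq> 0"
  shows "vec.span {v} \<in> proj_space"
  using assms by (simp add: proj_space_def vec.dim_span vec.dim_eq_card_independent
      vec.independent_insert vec.independent_empty)

lemma proj_space_subset_span_singleton:
  fixes v :: "complex^'n"
  assumes "P \<in> proj_space" and "P \<subseteq> vec.span {v}" and "v \<noteq> 0"
  shows "P = vec.span {v}"
  using assms span_singleton_in_proj_space[OF assms(3)] unfolding proj_space_def
  by (intro vec.subspace_dim_equal) auto

lemma ex1_proj_space_subset_span_singleton:
  fixes v :: "complex^'n"
  assumes "v \<noteq> 0"
  shows "\<exists>!P. P \<in> {P \<in> proj_space. P \<subseteq> vec.span {v}}"
  using span_singleton_in_proj_space[OF assms] proj_space_subset_span_singleton[OF _ _ assms]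
  by blast

text \<open>The coordinate \<open>p\<close> vanishes on all multiples of \<open>v\<close> but not on
  \<open>w\<close>, so the two vectors are independent.\<close>

lemma proj_line_span_pair:
  fixes v w :: "complex^'n"
  assumes "v $ p = 0" and "v \<noteq> 0" and "w $ p \<noteq> 0"
  shows "proj_line {P \<in> proj_space. P \<subseteq> vec.span {v, w}}"
proof (rule proj_linear_subspaceI)
  have "w \<notin> vec.span {v}"
    using assms by (auto simp: vec.span_singleton)
  then have "vec.independent {w, v}"
    using assms by (simp add: vec.independent_insert vec.independent_empty)
  moreover have "w \<noteq> v"
    using assms by auto
  ultimately show "vec.dim (vec.span {v, w}) = 1 + 1"
    by (simp add: vec.dim_span vec.dim_eq_card_independent insert_commute)
qed simp

text \<open>Two basis vectors of the cone span two different points. This makes the outcomes "line"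
  and "single point" exclusive.\<close>

lemma proj_line_not_ex1:
  fixes S :: "(complex^'n) set set"
  assumes "proj_line S"
  shows "\<not> (\<exists>!P. P \<in> S)"
proof -
  obtain W where W: "vec.subspace W" "vec.dim W = 2" and S: "S = {P \<in> proj_space. P \<subseteq> W}"
    using assms unfolding proj_linear_def by auto
  obtain B where B: "B \<subseteq> W" "vec.independent B" "card B = 2"
    using vec.basis_exists[of W] W by metis
  then obtain v w where vw: "B = {v, w}" "v \<noteq> w"
    by (auto simp: card_2_iff)
  have "0 \<notin> B"
    using B vec.dependent_zero by blast
  moreover have "v \<notin> vec.span {w}"
    using B vw by (simp add: vec.independent_insert)
  ultimately have ind: "v \<noteq> 0" "w \<noteq> 0" "v \<notin> vec.span {w}"
    using vw by auto
  have "vec.span {v} \<in> S" "vec.span {w} \<in> S"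
    using B vw W ind span_singleton_in_proj_space vec.span_minimal[of _ W] unfolding S by auto
  moreover have "vec.span {v} \<noteq> vec.span {w}"
    using ind vec.span_base[of v "{v}"] by auto
  ultimately show ?thesis by blast
qed

section \<open>The cones over the Pascal planes\<close>

text \<open>The indices live in the type \<open>6\<close> and the sum runs over \<open>-{0}\<close>,
  so that it can be expanded along any enumeration of the nonzero indices.\<close>

definition pascal_cone :: "complex \<Rightarrow> 6 \<Rightarrow> 6 \<Rightarrow> (complex^6) set" where
  "pascal_cone \<eta> s t =
     {x. (\<Sum>r\<in>-{0}. x $ r) = \<eta> * x $ 0 \<and> x $ s = - x $ 0 \<and> x $ t = x $ 0}"

text \<open>The type \<open>6\<close> is arithmetic modulo 6, so the numbers 1 to 5 keep distinct
  nonzero residues, and there are only five of these.\<close>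

lemma of_nat_6:
  "inj_on (of_nat :: nat \<Rightarrow> 6) {1..5}" "of_nat ` {1..5} = - {0 :: 6}"
proof -
  have I: "{1..5::nat} = {1, 2, 3, 4, 5}" by auto
  show inj: "inj_on (of_nat :: nat \<Rightarrow> 6) {1..5}"
    unfolding I inj_on_def by simp
  show "of_nat ` {1..5} = - {0 :: 6}"
  proof (rule card_subset_eq)
    show "of_nat ` {1..5} \<subseteq> - {0 :: 6}"
      unfolding I by simp
    show "card (of_nat ` {1..5} :: 6 set) = card (- {0 :: 6})"
      using card_image[OF inj] by (simp add: Compl_eq_Diff_UNIV)
  qed simp
qed

lemma pascal_plane_eq:
  "pascal_plane \<eta> i j = {P \<in> proj_space. P \<subseteq> pascal_cone \<eta> (of_nat i) (of_nat j)}"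
proof -
  have "(\<Sum>i=1..5. x $ of_nat i) = (\<Sum>r\<in>-{0}. x $ r)" for x :: "complex^6"
    using sum.reindex[OF of_nat_6(1), of "\<lambda>r. x $ r"] of_nat_6(2) by simp
  then show ?thesis
    unfolding pascal_plane_def L_space_def pascal_cone_def
    by (auto simp: subset_iff eq_neg_iff_add_eq_0 add.commute)
qed

lemma UNIV_6_eq:
  assumes "distinct [a, b, c, d, e, f :: 6]"
  shows "UNIV = {a, b, c, d, e, f}"
  using assms by (intro card_subset_eq[symmetric]) auto

lemma nonzero_6_eq:
  assumes "distinct [0, b, c, d, e, f :: 6]"
  shows "- {0} = {b, c, d, e, f}"
  using UNIV_6_eq[OF assms] assms by auto

lemma sum_nonzero_6:
  assumes "distinct [0, b, c, d, e, f :: 6]"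
  shows "(\<Sum>r\<in>-{0}. g r) = g b + g c + g d + g e + (g f :: complex)"
  using assms unfolding nonzero_6_eq[OF assms] by (simp add: add.assoc)

lemma vec_6_eq_iff:
  fixes x y :: "complex^6"
  assumes "distinct [a, b, c, d, e, f]"
  shows "x = y \<longleftrightarrow> x $ a = y $ a \<and> x $ b = y $ b \<and> x $ c = y $ c \<and> x $ d = y $ d
    \<and> x $ e = y $ e \<and> x $ f = y $ f"
proof -
  have "x = y \<longleftrightarrow> (\<forall>r\<in>{a, b, c, d, e, f}. x $ r = y $ r)"
    unfolding UNIV_6_eq[OF assms, symmetric] by (simp add: vec_eq_iff)
  then show ?thesis by simp
qed

text \<open>Names the coordinates left free by the equations. This replaces an appeal to the
  symmetry in the five indices and avoids enumerating their values.\<close>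

lemma extend_distinct_6:
  assumes "distinct (0 # rs)" and "length rs \<le> 5"
  obtains ss :: "6 list" where "distinct (0 # rs @ ss)" and "length ss = 5 - length rs"
proof -
  obtain ss where ss: "set ss = UNIV - set (0 # rs)" "distinct ss"
    using finite_distinct_list[of "UNIV - set (0 # rs)"] by auto
  have "length ss = 6 - card (set (0 # rs))"
    using ss card_Diff_subset[of "set (0 # rs)" UNIV]
    by (simp flip: distinct_card)
  also have "\<dots> = 5 - length rs"
    using distinct_card[OF assms(1)] by simp
  finally show ?thesis
    using that[of ss] ss assms by auto
qed

lemma span_pair_iff:
  fixes v w x :: "complex^'n"
  shows "x \<in> vec.span {v, w} \<longleftrightarrow> (\<exists>c d. x = c *s v + d *s w)"
  by (simp add: vec.span_insert vec.span_singleton image_iff diff_eq_eq add.commute)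

section \<open>Incidence of two cones\<close>

text \<open>
  The sign \<open>\<epsilon>\<close> covers both a common source (\<open>\<epsilon> = 1\<close>) and a common target (\<open>\<epsilon> = -1\<close>).
\<close>

lemma proj_line_shared_coordinate:
  fixes \<epsilon> :: complex and r s t :: 6
  assumes "distinct [0, r, s, t]"
    and W: "W = {x. (\<Sum>q\<in>-{0}. x $ q) = \<eta> * x $ 0 \<and> x $ r = - \<epsilon> * x $ 0
      \<and> x $ s = \<epsilon> * x $ 0 \<and> x $ t = \<epsilon> * x $ 0}"
  shows "proj_line {P \<in> proj_space. P \<subseteq> W}"
proof -
  obtain ss where ss: "distinct (0 # [r, s, t] @ ss)" "length ss = 2"
    using extend_distinct_6[of "[r, s, t]"] assms(1) by auto
  then obtain m n where "ss = [m, n]"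
    by (auto simp: length_Suc_conv numeral_2_eq_2)
  with ss have d: "distinct [0, r, s, t, m, n]" by simp
  \<comment> \<open>\<open>v\<close> spans the solutions with a = 0; \<open>w\<close> is a solution
    with a = 1. The entries of \<open>w\<close> at \<open>r\<close>, \<open>s\<close>,
    \<open>t\<close> add up to \<epsilon>, so the entry at \<open>m\<close> has to supply the
    remaining \<eta> - \<epsilon>.\<close>
  define v :: "complex^6" where "v = axis m 1 - axis n 1"
  define w :: "complex^6" where "w = (\<chi> q. if q = 0 then 1 else if q = r then - \<epsilon>
    else if q = s \<or> q = t then \<epsilon> else if q = m then \<eta> - \<epsilon> else 0)"
  have v: "v $ 0 = 0" "v $ r = 0" "v $ s = 0" "v $ t = 0" "v $ m = 1" "v $ n = -1"
    and w: "w $ 0 = 1" "w $ r = - \<epsilon>" "w $ s = \<epsilon>" "w $ t = \<epsilon>" "w $ m = \<eta> - \<epsilon>" "w $ n = 0"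
    using d by (auto simp: v_def w_def axis_def)
  have "x \<in> W \<longleftrightarrow> x \<in> vec.span {v, w}" for x
  proof
    assume "x \<in> W"
    then have "x = (x $ m - (\<eta> - \<epsilon>) * x $ 0) *s v + (x $ 0) *s w"
      unfolding vec_6_eq_iff[OF d] W mem_Collect_eq sum_nonzero_6[OF d]
      by (auto simp: v w algebra_simps)
    then show "x \<in> vec.span {v, w}"
      unfolding span_pair_iff by blast
  next
    assume "x \<in> vec.span {v, w}"
    then show "x \<in> W"
      unfolding span_pair_iff W mem_Collect_eq sum_nonzero_6[OF d]
      by (auto simp: v w algebra_simps)
  qed
  then have "W = vec.span {v, w}" by blast
  moreover have "v \<noteq> 0" using v(5) by auto
  ultimately show ?thesis
    using proj_line_span_pair[of v 0 w] v w by simp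
qed

text \<open>Both signs are imposed on each of the two coordinates, so a and these coordinates
  vanish. What is left is the plane of triples with sum zero.\<close>

lemma proj_line_opposite:
  fixes r s :: 6
  assumes "distinct [0, r, s]"
  shows "proj_line {P \<in> proj_space. P \<subseteq> pascal_cone \<eta> r s \<inter> pascal_cone \<eta> s r}"
proof -
  obtain ss where ss: "distinct (0 # [r, s] @ ss)" "length ss = 3"
    using extend_distinct_6[of "[r, s]"] assms by auto
  then obtain l m n where "ss = [l, m, n]"
    by (auto simp: length_Suc_conv numeral_3_eq_3)
  with ss have d: "distinct [0, r, s, l, m, n]" by simp
  define v w :: "complex^6" where "v = axis l 1 - axis n 1" and "w = axis m 1 - axis n 1"
  have v: "v $ 0 = 0" "v $ r = 0" "v $ s = 0" "v $ l = 1" "v $ m = 0" "v $ n = -1"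
    and w: "w $ 0 = 0" "w $ r = 0" "w $ s = 0" "w $ l = 0" "w $ m = 1" "w $ n = -1"
    using d by (auto simp: v_def w_def axis_def)
  have "x \<in> pascal_cone \<eta> r s \<inter> pascal_cone \<eta> s r \<longleftrightarrow> x \<in> vec.span {v, w}" for x
  proof
    assume "x \<in> pascal_cone \<eta> r s \<inter> pascal_cone \<eta> s r"
    then have "x = (x $ l) *s v + (x $ m) *s w"
      unfolding vec_6_eq_iff[OF d] pascal_cone_def Int_iff mem_Collect_eq sum_nonzero_6[OF d]
      by (auto simp: v w algebra_simps eq_neg_iff_add_eq_0)
    then show "x \<in> vec.span {v, w}"
      unfolding span_pair_iff by blast
  next
    assume "x \<in> vec.span {v, w}"
    then show "x \<in> pascal_cone \<eta> r s \<inter> pascal_cone \<eta> s r"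
      unfolding span_pair_iff pascal_cone_def Int_iff mem_Collect_eq sum_nonzero_6[OF d]
      by (auto simp: v w algebra_simps)
  qed
  then have "pascal_cone \<eta> r s \<inter> pascal_cone \<eta> s r = vec.span {v, w}" by blast
  moreover have "v \<noteq> 0" using v(4) by auto
  \<comment> \<open>Both vectors have a = 0, so the coordinate \<open>m\<close> has to separate
    them.\<close>
  ultimately show ?thesis
    using proj_line_span_pair[of v m w] v w by simp
qed

text \<open>The shared coordinate must equal both a and -a, so a and all three named coordinates
  vanish. The two free coordinates then add up to zero.\<close>

lemma ex1_consecutive:
  fixes r s t :: 6
  assumes "distinct [0, r, s, t]"
  shows "\<exists>!P. P \<in> {P \<in> proj_space. P \<subseteq> pascal_cone \<eta> r s \<inter> pascal_cone \<eta> s t}"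
proof -
  obtain ss where ss: "distinct (0 # [r, s, t] @ ss)" "length ss = 2"
    using extend_distinct_6[of "[r, s, t]"] assms(1) by auto
  then obtain m n where "ss = [m, n]"
    by (auto simp: length_Suc_conv numeral_2_eq_2)
  with ss have d: "distinct [0, r, s, t, m, n]" by simp
  define v :: "complex^6" where "v = axis m 1 - axis n 1"
  have v: "v $ 0 = 0" "v $ r = 0" "v $ s = 0" "v $ t = 0" "v $ m = 1" "v $ n = -1"
    using d by (auto simp: v_def axis_def)
  have "x \<in> pascal_cone \<eta> r s \<inter> pascal_cone \<eta> s t \<longleftrightarrow> x \<in> vec.span {v}" for x
  proof
    assume "x \<in> pascal_cone \<eta> r s \<inter> pascal_cone \<eta> s t"
    then have "x = (x $ m) *s v"
      unfolding vec_6_eq_iff[OF d] pascal_cone_def Int_iff mem_Collect_eq sum_nonzero_6[OF d]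
      by (auto simp: v algebra_simps eq_neg_iff_add_eq_0)
    then show "x \<in> vec.span {v}"
      unfolding vec.span_singleton by blast
  next
    assume "x \<in> vec.span {v}"
    then show "x \<in> pascal_cone \<eta> r s \<inter> pascal_cone \<eta> s t"
      unfolding vec.span_singleton pascal_cone_def Int_iff mem_Collect_eq sum_nonzero_6[OF d]
      by (auto simp: v)
  qed
  then have W: "pascal_cone \<eta> r s \<inter> pascal_cone \<eta> s t = vec.span {v}" by blast
  have "v \<noteq> 0" using v(5) by auto
  then show ?thesis
    unfolding W by (rule ex1_proj_space_subset_span_singleton)
qed

lemma ex1_disjoint:
  fixes r s t u :: 6
  assumes "distinct [0, r, s, t, u]"
  shows "\<exists>!P. P \<in> {P \<in> proj_space. P \<subseteq> pascal_cone \<eta> r s \<inter> pascal_cone \<eta> t u}"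
proof -
  obtain ss where ss: "distinct (0 # [r, s, t, u] @ ss)" "length ss = 1"
    using extend_distinct_6[of "[r, s, t, u]"] assms by auto
  then obtain m where "ss = [m]"
    by (auto simp: length_Suc_conv)
  with ss have d: "distinct [0, r, s, t, u, m]" by simp
  \<comment> \<open>The two entries -1 and the two entries 1 cancel in the sum, so the last
    coordinate carries all of \<eta>.\<close>
  define v :: "complex^6" where
    "v = (\<chi> q. if q = r \<or> q = t then - 1 else if q = m then \<eta> else 1)"
  have v: "v $ 0 = 1" "v $ r = -1" "v $ s = 1" "v $ t = -1" "v $ u = 1" "v $ m = \<eta>"
    using d by (auto simp: v_def)
  have "x \<in> pascal_cone \<eta> r s \<inter> pascal_cone \<eta> t u \<longleftrightarrow> x \<in> vec.span {v}" for x
  proof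
    assume "x \<in> pascal_cone \<eta> r s \<inter> pascal_cone \<eta> t u"
    then have "x = (x $ 0) *s v"
      unfolding vec_6_eq_iff[OF d] pascal_cone_def Int_iff mem_Collect_eq sum_nonzero_6[OF d]
      by (auto simp: v algebra_simps)
    then show "x \<in> vec.span {v}"
      unfolding vec.span_singleton by blast
  next
    assume "x \<in> vec.span {v}"
    then show "x \<in> pascal_cone \<eta> r s \<inter> pascal_cone \<eta> t u"
      unfolding vec.span_singleton pascal_cone_def Int_iff mem_Collect_eq sum_nonzero_6[OF d]
      by (auto simp: v algebra_simps)
  qed
  then have W: "pascal_cone \<eta> r s \<inter> pascal_cone \<eta> t u = vec.span {v}" by blast
  have "v \<noteq> 0" using v(1) by auto
  then show ?thesis
    unfolding W by (rule ex1_proj_space_subset_span_singleton)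
qed

text \<open>Two distinct directed edges share a source, share a target, are opposite, are
  consecutive in one of two orders, or are disjoint. Each type has its own lemma.\<close>

lemma pascal_cone_incidence:
  fixes r s t u :: 6 and \<eta> :: complex
  assumes "0 \<notin> {r, s, t, u}" and "r \<noteq> s" and "t \<noteq> u" and "(r, s) \<noteq> (t, u)"
  defines "S \<equiv> {P \<in> proj_space. P \<subseteq> pascal_cone \<eta> r s \<inter> pascal_cone \<eta> t u}"
  shows "r = t \<or> s = u \<or> (r, s) = (u, t) \<Longrightarrow> proj_line S"
    and "\<not> (r = t \<or> s = u \<or> (r, s) = (u, t)) \<Longrightarrow> \<exists>!P. P \<in> S"
proof -
  assume "r = t \<or> s = u \<or> (r, s) = (u, t)"
  then consider "r = t" | "s = u" | "r = u" "s = t" by auto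
  then show "proj_line S"
  proof cases
    case 1
    then show ?thesis
      unfolding S_def using assms
      by (intro proj_line_shared_coordinate[of r s u _ \<eta> 1]) (auto simp: pascal_cone_def)
  next
    case 2
    then show ?thesis
      unfolding S_def using assms
      by (intro proj_line_shared_coordinate[of s r t _ \<eta> "-1"]) (auto simp: pascal_cone_def)
  next
    case 3
    then show ?thesis
      unfolding S_def using assms proj_line_opposite[of r s \<eta>] by auto
  qed
next
  assume "\<not> (r = t \<or> s = u \<or> (r, s) = (u, t))"
  \<comment> \<open>Only \<open>s = t\<close> or \<open>r = u\<close> can still hold, and not both;
    \<open>r = u\<close> is the consecutive case with the two edges exchanged.\<close>
  then consider "s = t" "distinct [0, r, s, u]" | "r = u" "distinct [0, t, r, s]"
    | "distinct [0, r, s, t, u]"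
    using assms by fastforce
  then show "\<exists>!P. P \<in> S"
  proof cases
    case 1
    then show ?thesis unfolding S_def using ex1_consecutive[of r s u \<eta>] by simp
  next
    case 2
    then show ?thesis unfolding S_def using ex1_consecutive[of t r s \<eta>] by (simp add: Int_commute)
  next
    case 3
    then show ?thesis unfolding S_def by (rule ex1_disjoint)
  qed
qed

theorem proposition4p1:
  fixes \<eta> :: complex and i j k l :: nat
  assumes "\<eta>^2 = -3"
    and "i \<in> {1..5}" and "j \<in> {1..5}" and "i \<noteq> j"
    and "k \<in> {1..5}" and "l \<in> {1..5}" and "k \<noteq> l"
    and "(i, j) \<noteq> (k, l)"
  shows "(proj_line (pascal_plane \<eta> i j \<inter> pascal_plane \<eta> k l)
            \<longleftrightarrow> i = k \<or> j = l \<or> (i, j) = (l, k))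
       \<and> (\<not> (i = k \<or> j = l \<or> (i, j) = (l, k))
            \<longrightarrow> (\<exists>!P. P \<in> pascal_plane \<eta> i j \<inter> pascal_plane \<eta> k l))"
proof -
  define c where "c = (of_nat :: nat \<Rightarrow> 6)"
  have c: "c p = c q \<longleftrightarrow> p = q" if "p \<in> {1..5}" "q \<in> {1..5}" for p q
    using of_nat_6(1) that unfolding c_def inj_on_def by blast
  have nz: "c p \<noteq> 0" if "p \<in> {1..5}" for p
    using of_nat_6(2) that unfolding c_def by blast
  have S: "pascal_plane \<eta> i j \<inter> pascal_plane \<eta> k l =
      {P \<in> proj_space. P \<subseteq> pascal_cone \<eta> (c i) (c j) \<inter> pascal_cone \<eta> (c k) (c l)}"
    unfolding pascal_plane_eq c_def by blast
  have "0 \<notin> {c i, c j, c k, c l}" "c i \<noteq> c j" "c k \<noteq> c l" "(c i, c j) \<noteq> (c k, c l)"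
    using assms(2-) nz by (simp_all add: c)
  note inc = pascal_cone_incidence[OF this, of \<eta>]
  have "c i = c k \<or> c j = c l \<or> (c i, c j) = (c l, c k) \<longleftrightarrow> i = k \<or> j = l \<or> (i, j) = (l, k)"
    using assms(2-) by (simp add: c)
  \<comment> \<open>A line outside the three listed cases would consist of a single point, which
    \<open>proj_line_not_ex1\<close> rules out; this gives the "only if" direction.\<close>
  then show ?thesis
    using inc proj_line_not_ex1 unfolding S by blast
qed

end
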